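(* If a graph $G$ is $132$-representable, then there exists a $132$-avoiding word $w$ representing $G$ (possibly after relabelling the vertices of $G$) such that $n_w(x)\le 2$ for every letter $x$ occurring in $w$.
   Context: All graphs are finite and simple (no loops, no multiple edges), and vertex labels are taken from a totally ordered set. For a finite word $w$, $A(w)$ is the set of letters occurring in $w$, and $n_w(x)$ is the number of occurrences of the letter $x$ in $w$. Two distinct letters $x,y\in A(w)$ alternate in $w$ if deleting from $w$ all letters other than $x$ and $y$ leaves a word of the form $xyxy\cdots$ or $yxyx\cdots$ (of even or odd length). A word $w$ represents a graph $G=(V,E)$ if $A(w)=V$ and, for all $x\ne y$ in $V$, $x$ and $y$ alternate in $w$ if and only if $xy\in E$. A word $w=w_1\cdots w_m$ avoids the pattern $132$ (is $132$-avoiding) if there are no indices $i_1<i_2<i_3$ with $w_{i_1}<w_{i_3}<w_{i_2}$. A graph $G$ is $132$-representable if, possibly after relabelling its vertices by elements of a totally ordered set, there is a $132$-avoiding word that represents $G$. *)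

theory Defs
  imports "Graph_Theory.Graph_Theory"
begin

text \<open>
  A finite simple graph is a \<^locale>\<open>pair_graph\<close>: a finite, loopless, symmetric digraph whose arcs
  are pairs of vertices, an undirected edge \<open>xy\<close> being the two arcs \<open>(x, y)\<close> and \<open>(y, x)\<close>.
\<close>

definition alternating_word :: "'a \<Rightarrow> 'a \<Rightarrow> nat \<Rightarrow> 'a list" where
  "alternating_word x y n = map (\<lambda>i. if even i then x else y) [0..<n]"

definition alternate :: "'a list \<Rightarrow> 'a \<Rightarrow> 'a \<Rightarrow> bool" where
  "alternate w x y \<longleftrightarrow> x \<noteq> y \<and> x \<in> set w \<and> y \<in> set w \<and>
     (\<exists>n. filter (\<lambda>z. z = x \<or> z = y) w = alternating_word x y n \<or>
          filter (\<lambda>z. z = x \<or> z = y) w = alternating_word y x n)"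

definition represents :: "'a list \<Rightarrow> 'a pair_pre_digraph \<Rightarrow> bool" where
  "represents w G \<longleftrightarrow> set w = pverts G \<and>
     (\<forall>x\<in>pverts G. \<forall>y\<in>pverts G. x \<noteq> y \<longrightarrow> (alternate w x y \<longleftrightarrow> (x, y) \<in> parcs G))"

definition avoids_132 :: "'a::linorder list \<Rightarrow> bool" where
  "avoids_132 w \<longleftrightarrow>
     \<not> (\<exists>i j k. i < j \<and> j < k \<and> k < length w \<and> w ! i < w ! k \<and> w ! k < w ! j)"

definition relabel :: "('a \<Rightarrow> 'b) \<Rightarrow> 'a pair_pre_digraph \<Rightarrow> 'b pair_pre_digraph" where
  "relabel f G = \<lparr>pverts = f ` pverts G, parcs = map_prod f f ` parcs G\<rparr>"

text \<open>
  HOL cannot quantify existentially over the totally ordered set of labels, so the type \<open>'b\<close> of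
  labels is a parameter. It matters only through its size: a linear order with at least as many
  elements as the graph has vertices, such as \<open>nat\<close>, allows every possible relabelling up to
  order isomorphism.
\<close>

definition representable_132 :: "'b::linorder itself \<Rightarrow> 'a pair_pre_digraph \<Rightarrow> bool" where
  "representable_132 (_ :: 'b itself) G \<longleftrightarrow>
     (\<exists>(f :: 'a \<Rightarrow> 'b) w. inj_on f (pverts G) \<and> avoids_132 w \<and> represents w (relabel f G))"

end

theory Submission
  imports Defs "HOL-Library.Sublist"
begin

text \<open>
  Why it holds: if a letter \<open>x\<close> occurs at least three times in a 132-avoiding word, then it
  alternates with at most one letter. A letter that alternates with \<open>x\<close> occurs in each of the first
  two gaps between occurrences of \<open>x\<close>, and two such letters together with \<open>x\<close> always produce the
  pattern 132 (\<open>alternating_neighbour_unique\<close>). So the letters that occur too often are isolated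
  vertices or leaves of the graph, and the word can be rebuilt around them, one at a time:

  \<^item> An isolated \<open>x\<close> is deleted and replaced by \<open>xx\<close> at the front of the word, under a label larger
    than all the others. If \<open>x\<close> has a neighbour \<open>y\<close> that also occurs at least three times, then
    \<open>x\<close> and \<open>y\<close> form a component of the graph, and \<open>xyxy\<close> at the front replaces both
    (\<open>alternation_iso_prepend\<close>).

  \<^item> If the neighbour \<open>y\<close> occurs at most twice, then the word has the form \<open>..x..y..x..y..x..\<close>. All
    occurrences of \<open>x\<close> are deleted and the first \<open>y\<close> is replaced by the block \<open>xyx\<close>. Since no other
    letter stands between these two occurrences of \<open>x\<close>, the only neighbour of \<open>x\<close> is still \<open>y\<close>. If
    \<open>x < y\<close> the label of \<open>x\<close> can stay; if \<open>y < x\<close> the new label of \<open>x\<close> is placed immediately above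
    \<open>y\<close> (\<open>alternation_iso_leaf\<close>).

  Every step makes the word shorter and preserves both the graph and the avoidance of 132, so the
  process ends with a word in which no letter occurs three times.

  The new labels do not fit into an arbitrary linear order. The rebuilding is therefore done over the
  natural numbers, where labels can be spread out. Both alternation and the pattern are invariant
  under strictly increasing maps, and the final word has as many distinct letters as the original, so its
  letters can be renamed monotonically to the original labels (\<open>avoids_132_two_occurrences\<close>).
\<close>

section \<open>Alternation\<close>

lemma alternating_word_Suc:
  "alternating_word x y (Suc n) = x # alternating_word y x n"
  unfolding alternating_word_def
  by (simp add: map_upt_Suc comp_def del: upt_Suc)

text \<open>
  A word over two letters is alternating exactly when no two adjacent letters are equal. This replaces
  the two possible starting letters and the unknown length by one condition that is well behaved
  under concatenation and injective maps.
\<close>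

lemma distinct_adj_alternating_word:
  "x \<noteq> y \<Longrightarrow> distinct_adj (alternating_word x y n)"
proof (induction n arbitrary: x y)
  case 0
  then show ?case by (simp add: alternating_word_def)
next
  case (Suc n)
  then have "distinct_adj (alternating_word y x n)" by simp
  then show ?case
    using Suc.prems
    by (cases n) (simp_all add: alternating_word_Suc, simp add: alternating_word_def)
qed

lemma distinct_adj_imp_alternating_word:
  assumes "distinct_adj xs" "set xs \<subseteq> {x, y}"
  shows "xs = alternating_word x y (length xs) \<or> xs = alternating_word y x (length xs)"
  using assms
proof (induction xs)
  case Nil
  then show ?case by (simp add: alternating_word_def)
next
  case (Cons a xs)
  have a: "a = x \<or> a = y" using Cons.prems by auto
  have IH: "xs = alternating_word x y (length xs) \<or> xs = alternating_word y x (length xs)"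
    using Cons by (auto dest: distinct_adj_ConsD)
  show ?case
  proof (cases "length xs")
    case 0
    then show ?thesis using a by (auto simp: alternating_word_def)
  next
    case (Suc n)
    then have "xs \<noteq> []" by auto
    then have "a \<noteq> hd xs" using Cons.prems by (auto simp: distinct_adj_Cons)
    moreover have "hd (alternating_word s t (length xs)) = s" for s t :: 'a
      by (simp add: Suc alternating_word_Suc)
    ultimately show ?thesis
      using a IH by (metis alternating_word_Suc length_Cons)
  qed
qed

lemma alternate_iff_distinct_adj:
  "alternate w x y \<longleftrightarrow> x \<noteq> y \<and> x \<in> set w \<and> y \<in> set w \<and>
     distinct_adj (filter (\<lambda>z. z = x \<or> z = y) w)"
proof (cases "x \<noteq> y \<and> x \<in> set w \<and> y \<in> set w")
  case True
  let ?f = "filter (\<lambda>z. z = x \<or> z = y) w"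
  have "?f = alternating_word x y (length ?f) \<or> ?f = alternating_word y x (length ?f)"
    if "distinct_adj ?f"
    using that by (rule distinct_adj_imp_alternating_word) auto
  moreover have "distinct_adj ?f" if "?f = alternating_word x y n \<or> ?f = alternating_word y x n" for n
    using that
  proof
    assume "?f = alternating_word x y n"
    then show ?thesis using True distinct_adj_alternating_word by auto
  next
    assume "?f = alternating_word y x n"
    then show ?thesis using True distinct_adj_alternating_word[OF not_sym, of x y n] by simp
  qed
  ultimately have "distinct_adj ?f \<longleftrightarrow>
      (\<exists>n. ?f = alternating_word x y n \<or> ?f = alternating_word y x n)"
    by blast
  then show ?thesis using True by (simp add: alternate_def)
qed (auto simp: alternate_def)

lemma alternate_commute: "alternate w x y \<longleftrightarrow> alternate w y x"
proof -
  have "filter (\<lambda>z. z = x \<or> z = y) w = filter (\<lambda>z. z = y \<or> z = x) w"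
    by (intro filter_cong) auto
  then show ?thesis unfolding alternate_iff_distinct_adj by auto
qed

lemma alternate_map:
  assumes "inj_on g (set w)" "x \<in> set w" "y \<in> set w"
  shows "alternate (map g w) (g x) (g y) \<longleftrightarrow> alternate w x y"
proof -
  let ?P = "\<lambda>z. z = x \<or> z = y"
  have "filter (\<lambda>z. z = g x \<or> z = g y) (map g w) = map g (filter ?P w)"
    unfolding filter_map comp_def
    using assms by (intro arg_cong[of _ _ "map g"] filter_cong) (auto simp: inj_on_def)
  moreover have "inj_on g (set (filter ?P w))"
    using assms(1) by (rule inj_on_subset) auto
  moreover have "g x = g y \<longleftrightarrow> x = y" using assms by (rule inj_on_eq_iff)
  ultimately show ?thesis
    using assms(2,3) by (simp add: alternate_iff_distinct_adj distinct_adj_map_iff)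
qed

lemma alternate_filter:
  assumes "P x" "P y"
  shows "alternate (filter P w) x y \<longleftrightarrow> alternate w x y"
proof -
  have "filter (\<lambda>z. z = x \<or> z = y) (filter P w) = filter (\<lambda>z. z = x \<or> z = y) w"
    unfolding filter_filter using assms by (intro filter_cong) auto
  then show ?thesis using assms by (auto simp: alternate_iff_distinct_adj)
qed

text \<open>
  Between two occurrences of \<open>x\<close>, which need not be consecutive, a segment without \<open>y\<close> would bring
  two letters \<open>x\<close> together after restriction to \<open>x\<close> and \<open>y\<close>.
\<close>

lemma alternate_between:
  assumes "alternate (P @ x # Q @ x # R) x y"
  shows "y \<in> set Q"
proof (rule ccontr)
  assume "y \<notin> set Q"
  then have "set (filter (\<lambda>z. z = x \<or> z = y) Q) \<subseteq> {x}" by auto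
  then have Q: "filter (\<lambda>z. z = x \<or> z = y) Q = replicate n x"
    if "n = length (filter (\<lambda>z. z = x \<or> z = y) Q)" for n
    unfolding that by (intro replicate_length_same[symmetric]) auto
  have "distinct_adj (x # filter (\<lambda>z. z = x \<or> z = y) Q @ x # filter (\<lambda>z. z = x \<or> z = y) R)"
    using assms by (auto simp: alternate_iff_distinct_adj)
  then have "distinct_adj (x # replicate n x @ x # filter (\<lambda>z. z = x \<or> z = y) R)"
    if "n = length (filter (\<lambda>z. z = x \<or> z = y) Q)" for n
    using Q[OF that] by simp
  then show False
    by (cases "length (filter (\<lambda>z. z = x \<or> z = y) Q)") force+
qed

lemma not_alternate_adjacent:
  "z \<noteq> y \<Longrightarrow> z \<noteq> x \<Longrightarrow> \<not> alternate (P @ [x, y, x] @ Q) x z"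
  using alternate_between[of P x "[y]" Q z] by auto

section \<open>Avoiding 132\<close>

lemma set_subseq: "subseq u w \<Longrightarrow> set u \<subseteq> set w"
  by (induction rule: list_emb.induct) auto

lemma subseq_mapE:
  assumes "subseq v (map f w)"
  obtains u where "subseq u w" "v = map f u"
  using assms unfolding subseq_conv_nths by (auto simp: nths_map)

lemma subseq_Cons_append_notin:
  "a \<notin> set v \<Longrightarrow> subseq (a # u) (v @ w) \<longleftrightarrow> subseq (a # u) w"
  by (induction v) auto

lemma subseq_Cons_iff_nth:
  "subseq (a # u) w \<longleftrightarrow> (\<exists>i<length w. w ! i = a \<and> subseq u (drop (Suc i) w))"
proof
  assume "subseq (a # u) w"
  then obtain us vs where "w = us @ a # vs" "subseq u vs"
    by (blast dest: list_emb_ConsD)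
  then show "\<exists>i<length w. w ! i = a \<and> subseq u (drop (Suc i) w)"
    by (intro exI[of _ "length us"]) auto
next
  assume "\<exists>i<length w. w ! i = a \<and> subseq u (drop (Suc i) w)"
  then obtain i where "i < length w" "w ! i = a" "subseq u (drop (Suc i) w)" by blast
  then have "subseq (take i w @ a # u) (take i w @ a # drop (Suc i) w)"
    by (simp add: subseq_append')
  then show "subseq (a # u) w"
    using \<open>i < length w\<close> \<open>w ! i = a\<close>
    by (metis id_take_nth_drop list_emb_append2 subseq_order.refl subseq_order.trans)
qed

text \<open>
  Subsequences, unlike positions, are compatible with deleting letters and with decompositions of
  the word.
\<close>

lemma avoids_132_iff_subseq:
  "avoids_132 w \<longleftrightarrow> (\<forall>a b c. subseq [a, c, b] w \<longrightarrow> \<not> (a < b \<and> b < c))"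
proof -
  have eq: "subseq [a, c, b] w \<longleftrightarrow>
      (\<exists>i j k. i < j \<and> j < k \<and> k < length w \<and> w ! i = a \<and> w ! j = c \<and> w ! k = b)" (is "?L \<longleftrightarrow> ?R")
    for a b c
  proof
    assume ?L
    then obtain i j k where "i < length w" "w ! i = a" "j < length (drop (Suc i) w)"
      "drop (Suc i) w ! j = c" "k < length (drop (Suc j) (drop (Suc i) w))"
      "drop (Suc j) (drop (Suc i) w) ! k = b"
      unfolding subseq_Cons_iff_nth by blast
    then show ?R
      by (intro exI[of _ i] exI[of _ "Suc i + j"] exI[of _ "Suc i + (Suc j + k)"])
        (auto simp: ac_simps)
  next
    assume ?R
    then obtain i j k where ijk: "i < j" "j < k" "k < length w" "w ! i = a" "w ! j = c" "w ! k = b"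
      by blast
    have "subseq [b] (drop (Suc j) w)"
      unfolding subseq_Cons_iff_nth using ijk by (intro exI[of _ "k - Suc j"]) auto
    then have "subseq [c, b] (drop (Suc i) w)"
      unfolding subseq_Cons_iff_nth[of c] using ijk by (intro exI[of _ "j - Suc i"]) auto
    then show ?L
      unfolding subseq_Cons_iff_nth[of a] using ijk by (intro exI[of _ i]) auto
  qed
  show ?thesis unfolding avoids_132_def eq by blast
qed

lemma avoids_132_subseq: "subseq u w \<Longrightarrow> avoids_132 w \<Longrightarrow> avoids_132 u"
  unfolding avoids_132_iff_subseq using subseq_order.trans by blast

lemma avoids_132_map:
  assumes "strict_mono_on (set w) h"
  shows "avoids_132 (map h w) \<longleftrightarrow> avoids_132 w"
proof -
  have "map h w ! i < map h w ! j \<longleftrightarrow> w ! i < w ! j" if "i < length w" "j < length w" for i j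
    using strict_mono_on_less[OF assms] that by simp
  then have "(i < j \<and> j < k \<and> k < length w \<and> map h w ! i < map h w ! k \<and> map h w ! k < map h w ! j) \<longleftrightarrow>
      (i < j \<and> j < k \<and> k < length w \<and> w ! i < w ! k \<and> w ! k < w ! j)" for i j k
    by (meson order.strict_trans)
  then show ?thesis unfolding avoids_132_def length_map by simp
qed

text \<open>
  A pattern across the border would start with its smallest letter in \<open>p\<close> and end in \<open>u\<close>, against
  the order between the two words.
\<close>

lemma avoids_132_append:
  assumes "avoids_132 p" "avoids_132 u" "\<And>a b. a \<in> set p \<Longrightarrow> b \<in> set u \<Longrightarrow> b < a"
  shows "avoids_132 (p @ u)"
  unfolding avoids_132_iff_subseq
proof (intro allI impI notI)
  fix a b c
  assume s: "subseq [a, c, b] (p @ u)" and lt: "a < b \<and> b < c"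
  from s obtain xs ys where xy: "[a, c, b] = xs @ ys" "subseq xs p" "subseq ys u"
    by (rule subseq_appendE)
  have "\<not> (a \<in> set p \<and> b \<in> set u)"
    using assms(3)[of a b] lt by auto
  moreover have "set xs \<subseteq> set p" "set ys \<subseteq> set u"
    using xy set_subseq by blast+
  ultimately have "xs = [] \<or> ys = []"
    using xy(1) by (auto simp: Cons_eq_append_conv)
  then show False
    using xy assms(1,2) lt unfolding avoids_132_iff_subseq by auto
qed

text \<open>
  A pattern in the new word must involve \<open>x\<close>. The hypotheses exclude its three roles: as the
  smallest letter \<open>x\<close> is followed only by \<open>y # B\<close>, in which the letters above \<open>x\<close> do not descend;
  before either occurrence of \<open>x\<close>, only \<open>y\<close> can be smaller than \<open>x\<close>. With \<open>y\<close> directly before the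
  second \<open>x\<close>, this leaves only a pattern \<open>y x b\<close> with \<open>y < b < x\<close>.
\<close>

lemma avoids_132_insert:
  assumes "avoids_132 (A @ y # B)"
    and x: "x \<notin> set B" "x \<noteq> y"
    and A: "\<And>a. a \<in> set A \<Longrightarrow> x < a"
    and B: "\<And>b c. subseq [c, b] (y # B) \<Longrightarrow> x < b \<Longrightarrow> \<not> b < c"
    and y: "\<And>b. b \<in> set B \<Longrightarrow> y < b \<Longrightarrow> \<not> b < x"
  shows "avoids_132 (A @ [x, y, x] @ B)"
  unfolding avoids_132_iff_subseq
proof (intro allI impI notI)
  let ?v = "A @ [x, y, x] @ B"
  fix a b c
  assume s: "subseq [a, c, b] ?v" and lt: "a < b \<and> b < c"
  have xA: "x \<notin> set A" using A by blast
  have fA: "filter (\<lambda>z. z \<noteq> x) A = A" and fB: "filter (\<lambda>z. z \<noteq> x) B = B"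
    using x xA by (auto simp: filter_id_conv)
  show False
  proof (cases "x \<in> {a, b, c}")
    case False
    then have "subseq [a, c, b] (A @ y # B)"
      using subseq_filter[OF s, of "\<lambda>z. z \<noteq> x"] x fA fB by auto
    then show False using assms(1) lt unfolding avoids_132_iff_subseq by blast
  next
    case True
    then consider "a = x" | "b = x" | "c = x" by blast
    then show False
    proof cases
      \<comment> \<open>Whichever occurrence of \<open>x\<close> starts the pattern, the first one can be taken instead.\<close>
      case 1
      then have "b \<noteq> x" "c \<noteq> x" using lt by auto
      have "subseq [c, b] ([y, x] @ B)"
        using s xA 1 by (simp add: subseq_Cons_append_notin)
      from subseq_filter[OF this, of "\<lambda>z. z \<noteq> x"] have "subseq [c, b] (y # B)"
        using fB x \<open>b \<noteq> x\<close> \<open>c \<noteq> x\<close> by simp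
      then show False using B lt 1 by blast
    next
      case 2
      have "a \<notin> set A" using A[of a] lt 2 by auto
      then have "subseq [a, c, x] (y # x # B)"
        using s lt 2 by (auto simp: subseq_Cons_append_notin)
      then have "subseq [c, x] B \<or> subseq [a, c, x] B"
        using lt 2 by (auto split: if_splits)
      then show False using x(1) by (auto dest!: set_subseq)
    next
      case 3
      have "a \<notin> set A" using A[of a] lt 3 by fastforce
      then have "subseq [a, x, b] (y # x # B)"
        using s lt 3 by (auto simp: subseq_Cons_append_notin)
      then have "a = y \<and> subseq [b] B \<or> subseq [a, x, b] B"
        using lt 3 by (auto split: if_splits)
      then have "a = y" "b \<in> set B" using x(1) by (auto dest!: set_subseq)
      then show False using y[of b] lt 3 by auto
    qed
  qed
qed

section \<open>Letters with three occurrences\<close>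

lemma length_filter_neq: "length w = length (filter (\<lambda>z. z \<noteq> x) w) + count_list w x"
  by (induction w) auto

lemma count_list_ge_3_split:
  assumes "count_list w x \<ge> 3"
  obtains P Q R S where "w = P @ x # Q @ x # R @ x # S"
proof -
  obtain n where "count_list w x = Suc (Suc (Suc n))"
    using assms by (metis add_2_eq_Suc' eval_nat_numeral(3) le_Suc_ex plus_nat.simps(2) add.commute)
  then show thesis
    using that by (metis count_list_Suc_split_first)
qed

text \<open>
  Both neighbours \<open>y < z\<close> of \<open>x\<close> occur in each of the first two gaps between occurrences of \<open>x\<close>. The
  word then contains \<open>x z y\<close>, \<open>y x z\<close> and \<open>y z x\<close>, and one of them is a 132 pattern whatever the
  rank of \<open>x\<close> is: the first if \<open>x < y\<close>, the second if \<open>z < x\<close>, the third if \<open>y < x < z\<close>.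
\<close>

lemma alternating_neighbour_unique:
  fixes w :: "'a :: linorder list"
  assumes w: "avoids_132 w" and n: "count_list w x \<ge> 3"
    and y: "alternate w x y" and z: "alternate w x z"
  shows "y = z"
proof -
  obtain P Q R S where PQRS: "w = P @ x # Q @ x # R @ x # S"
    using n by (rule count_list_ge_3_split)
  have QR: "t \<in> set Q \<and> t \<in> set R" if "alternate w x t" for t
    using alternate_between[of P x Q "R @ x # S" t] alternate_between[of "P @ x # Q" x R S t]
      that PQRS by auto
  have False if yz: "alternate w x y" "alternate w x z" "y < z" for y z
  proof -
    have "y \<noteq> x" "z \<noteq> x" using yz by (auto simp: alternate_def)
    obtain Q1 Q2 where Q: "Q = Q1 @ y # Q2" using QR yz(1) by (meson split_list)
    obtain Q3 Q4 where Q': "Q = Q3 @ z # Q4" using QR yz(2) by (meson split_list)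
    obtain R1 R2 where R: "R = R1 @ z # R2" using QR yz(2) by (meson split_list)
    obtain R3 R4 where R': "R = R3 @ y # R4" using QR yz(1) by (meson split_list)
    have "subseq [x, z, y] w"
      unfolding PQRS unfolding Q' unfolding R' by (simp add: list_emb_append2 subseq_singleton_left)
    moreover have "subseq [y, x, z] w" "subseq [y, z, x] w"
      unfolding PQRS unfolding Q unfolding R by (simp_all add: list_emb_append2 subseq_singleton_left)
    ultimately show False
      using w yz(3) \<open>y \<noteq> x\<close> \<open>z \<noteq> x\<close> unfolding avoids_132_iff_subseq
      by (metis linorder_neqE)
  qed
  then show ?thesis using y z by (metis linorder_neqE)
qed

lemma alternate_count_pattern:
  assumes a: "alternate w x y" and x: "count_list w x \<ge> 3" and y: "count_list w y \<le> 2"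
  shows "filter (\<lambda>z. z = x \<or> z = y) w = [x, y, x, y, x]"
proof -
  let ?f = "filter (\<lambda>z. z = x \<or> z = y) w"
  have "x \<noteq> y" using a by (simp add: alternate_def)
  have c: "count_list (alternating_word s t n) s = (n + 1) div 2 \<and>
      count_list (alternating_word s t n) t = n div 2" if "s \<noteq> t" for s t :: 'a and n
    using that
  proof (induction n arbitrary: s t)
    case 0
    then show ?case by (simp add: alternating_word_def)
  next
    case (Suc n)
    then show ?case by (auto simp: alternating_word_Suc)
  qed
  have f: "count_list ?f t = count_list w t" if "t = x \<or> t = y" for t
    using that by (induction w) auto
  obtain n where "?f = alternating_word x y n \<or> ?f = alternating_word y x n"
    using a by (auto simp: alternate_def)
  then show ?thesis
  proof
    assume *: "?f = alternating_word x y n"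
    then have "(n + 1) div 2 \<ge> 3" "n div 2 \<le> 2"
      using c[of x y n] f x y \<open>x \<noteq> y\<close> by auto
    then have "n = 5" by linarith
    then show ?thesis using * by (simp add: alternating_word_def upt_rec)
  next
    assume *: "?f = alternating_word y x n"
    then have "(n + 1) div 2 \<le> 2" "n div 2 \<ge> 3"
      using c[of y x n] f x y \<open>x \<noteq> y\<close> by auto
    then show ?thesis by linarith
  qed
qed

section \<open>Rebuilding a word around an isolated letter or a leaf\<close>

text \<open>
  This is an isomorphism between the graphs represented by \<open>w\<close> and \<open>v\<close>, stated without the graphs.
\<close>

definition alternation_iso :: "('a \<Rightarrow> 'b) \<Rightarrow> 'a list \<Rightarrow> 'b list \<Rightarrow> bool" where
  "alternation_iso g w v \<longleftrightarrow> bij_betw g (set w) (set v) \<and>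
     (\<forall>x\<in>set w. \<forall>y\<in>set w. alternate v (g x) (g y) \<longleftrightarrow> alternate w x y)"

lemma alternation_iso_trans:
  assumes "alternation_iso g u v" "alternation_iso h v w"
  shows "alternation_iso (h \<circ> g) u w"
  using assms bij_betw_trans[of g "set u" "set v" h "set w"]
  unfolding alternation_iso_def by (auto dest: bij_betwE)

lemma alternation_iso_map:
  assumes "inj_on g (set w)" shows "alternation_iso g w (map g w)"
  using assms alternate_map[OF assms] by (simp add: alternation_iso_def inj_on_imp_bij_betw)

lemma alternation_iso_id:
  assumes "set v = set w"
    and "\<And>x y. x \<in> set w \<Longrightarrow> y \<in> set w \<Longrightarrow> alternate v x y \<longleftrightarrow> alternate w x y"
  shows "alternation_iso id w v"
  using assms by (simp add: alternation_iso_def)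

text \<open>
  The letters of \<open>p\<close> form a union of components of the graph of \<open>w\<close>. They are moved to the front and
  raised above all other labels. The two occurrences required of each of them keep them from
  alternating with the rest: every other letter now comes after both.
\<close>

lemma alternation_iso_prepend:
  fixes w :: "nat list"
  assumes w: "avoids_132 w"
    and p: "set p \<subseteq> set w" "avoids_132 p" "\<And>x. x \<in> set p \<Longrightarrow> count_list p x \<ge> 2"
    and alt: "\<And>x y. x \<in> set p \<Longrightarrow> y \<in> set w \<Longrightarrow> alternate w x y \<longleftrightarrow> alternate p x y"
  obtains v :: "nat list" and g where "alternation_iso g w v" "avoids_132 v"
    "length v = length p + length (filter (\<lambda>z. z \<notin> set p) w)"
proof -
  let ?u = "filter (\<lambda>z. z \<notin> set p) w"
  define M where "M = Suc (Max (set w))"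
  define g where "g z = (if z \<in> set p then M + z else z)" for z
  have M: "z < M" if "z \<in> set w" for z using that by (simp add: M_def less_Suc_eq_le)
  have inj: "inj_on g (set w)" using M by (fastforce simp: inj_on_def g_def)
  have set: "set (p @ ?u) = set w" using p(1) by auto
  have cross: "\<not> alternate (p @ ?u) x y" if x: "x \<in> set p" and y: "y \<notin> set p" for x y
  proof -
    obtain n where "count_list p x = Suc (Suc n)"
      using p(3)[OF x] by (metis add_2_eq_Suc le_Suc_ex)
    then obtain P Q R where "p = P @ x # Q @ x # R" by (metis count_list_Suc_split_first)
    then show ?thesis using alternate_between[of P x Q "R @ ?u" y] y by auto
  qed
  have fp: "filter (\<lambda>z. z \<in> set p) (p @ ?u) = p" "filter (\<lambda>z. z \<notin> set p) (p @ ?u) = ?u"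
    by (auto simp: filter_id_conv filter_empty_conv)
  have np: "\<not> alternate p x y" if "y \<notin> set p" for x y using that by (auto simp: alternate_def)
  have "alternate (p @ ?u) x y \<longleftrightarrow> alternate w x y" if "x \<in> set w" "y \<in> set w" for x y
  proof -
    consider "x \<in> set p" "y \<in> set p" | "x \<in> set p" "y \<notin> set p" | "x \<notin> set p" "y \<in> set p"
      | "x \<notin> set p" "y \<notin> set p" by blast
    then show ?thesis
    proof cases
      case 1
      then show ?thesis
        using alternate_filter[of "\<lambda>z. z \<in> set p" x y "p @ ?u"] fp alt that by simp
    next
      case 2
      then show ?thesis using cross alt np that by blast
    next
      case 3
      then show ?thesis using cross alt np that alternate_commute by metis
    next
      case 4
      then show ?thesis
        using alternate_filter[of "\<lambda>z. z \<notin> set p" x y "p @ ?u"]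
          alternate_filter[of "\<lambda>z. z \<notin> set p" x y w] fp by simp
    qed
  qed
  then have "alternation_iso id w (p @ ?u)" using set by (intro alternation_iso_id) auto
  from alternation_iso_trans[OF this alternation_iso_map[of g "p @ ?u"]]
  have "alternation_iso g w (map g (p @ ?u))" using inj set by simp
  moreover have "avoids_132 (map g (p @ ?u))"
  proof -
    have "strict_mono_on (set p) g" by (auto simp: g_def strict_mono_on_def)
    then have "avoids_132 (map g p)" using p(2) by (simp add: avoids_132_map)
    moreover have "avoids_132 (map g ?u)"
    proof -
      have "map g ?u = ?u" by (rule map_idI) (auto simp: g_def)
      then show ?thesis using w avoids_132_subseq[of ?u w] by simp
    qed
    ultimately show ?thesis unfolding map_append
      by (rule avoids_132_append) (use M in \<open>auto simp: g_def intro: trans_less_add1\<close>)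
  qed
  ultimately show thesis using that[of g "map g (p @ ?u)"] by simp
qed

text \<open>
  The two counts force the restriction of \<open>w\<close> to these two letters to be \<open>x y x y x\<close>. Replacing
  \<open>y\<close> by the block \<open>x y x\<close> at its first occurrence is compatible with the order because the last
  \<open>x\<close> and the second \<open>y\<close> of \<open>w\<close> bound everything before that occurrence from below: no letter there
  is smaller than both \<open>x\<close> and \<open>y\<close>.
\<close>

lemma alternation_iso_leaf:
  fixes w :: "nat list"
  assumes w: "avoids_132 w" and alt: "alternate w x y"
    and x: "count_list w x \<ge> 3" and y: "count_list w y \<le> 2"
  obtains v :: "nat list" and g where "alternation_iso g w v" "avoids_132 v" "length v < length w"
proof -
  have pat: "filter (\<lambda>z. z = x \<or> z = y) w = [x, y, x, y, x]"
    using assms by (intro alternate_count_pattern)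
  have xy: "x \<noteq> y" "y \<in> set w" using alt by (auto simp: alternate_def)
  obtain P R where PR: "w = P @ y # R" "y \<notin> set P" using xy by (meson split_list_first)
  have split: "s = [x] \<and> t = [x, y, x]" if "s @ y # t = [x, y, x, y, x]" "y \<notin> set s" for s t
    using that xy by (auto simp: append_eq_Cons_conv)
  have "filter (\<lambda>z. z = x \<or> z = y) P @ y # filter (\<lambda>z. z = x \<or> z = y) R = [x, y, x, y, x]"
    using pat PR(1) by simp
  from split[OF this] have FP: "filter (\<lambda>z. z = x \<or> z = y) P = [x]"
    and FR: "filter (\<lambda>z. z = x \<or> z = y) R = [x, y, x]"
    using PR(2) by auto
  have xP: "x \<in> set P" using filter_is_subset[of "\<lambda>z. z = x \<or> z = y" P] FP by simp
  have "subseq [x, y, x] R" using FR by (metis subseq_filter_left)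
  then have R: "subseq [x, y] R" "x \<in> set R"
    using subseq_order.trans[of "[x, y]" "[x, y, x]" R]
    by (auto dest: list_emb_set)
  define A where "A = filter (\<lambda>z. z \<noteq> x) P"
  define B where "B = filter (\<lambda>z. z \<noteq> x) R"
  have u: "filter (\<lambda>z. z \<noteq> x) w = A @ y # B" using PR xy by (simp add: A_def B_def)
  let ?v = "A @ [x, y, x] @ B"
  have fv: "filter (\<lambda>z. z \<noteq> x) ?v = filter (\<lambda>z. z \<noteq> x) w"
    unfolding u using xy by (simp add: A_def B_def)
  have setv: "set ?v = set w" using PR xP by (auto simp: A_def B_def)
  have vxy: "alternate ?v x y"
  proof -
    have "filter (\<lambda>z. z = x \<or> z = y) A = []" using PR(2) by (auto simp: A_def filter_empty_conv)
    moreover have "filter (\<lambda>z. z = x \<or> z = y) B = filter (\<lambda>z. z \<noteq> x) (filter (\<lambda>z. z = x \<or> z = y) R)"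
      unfolding B_def filter_filter by (rule filter_cong) auto
    ultimately show ?thesis using FR xy by (simp add: alternate_iff_distinct_adj)
  qed
  have only_y: "z = y" if "alternate w x z" for z
    using alternating_neighbour_unique[OF w x alt that] by simp
  have vx: "alternate ?v x z \<longleftrightarrow> alternate w x z" for z
  proof (cases "z = y")
    case True
    then show ?thesis using vxy alt by simp
  next
    case False
    have "\<not> alternate ?v x z"
    proof (cases "z = x")
      case True
      then show ?thesis by (simp add: alternate_def)
    next
      case False
      then show ?thesis using \<open>z \<noteq> y\<close> by (rule not_alternate_adjacent[rotated])
    qed
    then show ?thesis using only_y[of z] False by blast
  qed
  have "alternate ?v s t \<longleftrightarrow> alternate w s t" for s t
  proof (cases "s = x \<or> t = x")
    case True
    then show ?thesis using vx alternate_commute by metis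
  next
    case False
    then show ?thesis
      using alternate_filter[of "\<lambda>z. z \<noteq> x" s t ?v] alternate_filter[of "\<lambda>z. z \<noteq> x" s t w] fv by simp
  qed
  then have v: "alternation_iso id w ?v" using setv by (intro alternation_iso_id) auto
  have len: "length ?v < length w"
    using x length_filter_neq[of w x] unfolding u by simp
  have wu: "avoids_132 (A @ y # B)" using w avoids_132_subseq[of "A @ y # B" w] u
    by (metis subseq_filter_left)
  have RB: "subseq s B \<Longrightarrow> subseq s R" for s
    unfolding B_def using subseq_filter_left subseq_order.trans by blast
  \<comment> \<open>If \<open>x < y\<close>, a letter \<open>a < x\<close> before the first \<open>y\<close> would form \<open>a y x\<close>. If \<open>y < x\<close>, a letter
    \<open>a < y\<close> there would form \<open>a x y\<close>; but letters between \<open>y\<close> and \<open>x\<close> may occur there, so \<open>x\<close> has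
    to move down next to \<open>y\<close>.\<close>
  consider "x < y" | "y < x" using xy by linarith
  then show thesis
  proof cases
    case 1
    have "avoids_132 ?v"
    proof (rule avoids_132_insert[OF wu])
      fix a assume a: "a \<in> set A"
      then have "subseq ([a] @ [y] @ [x]) (P @ [y] @ R)"
        using R(2) by (intro list_emb_append_mono) (auto simp: A_def subseq_singleton_left)
      then have "\<not> a < x" using w 1 PR(1) unfolding avoids_132_iff_subseq by auto
      then show "x < a" using a by (auto simp: A_def)
    next
      fix b c assume "subseq [c, b] (y # B)" "x < b"
      moreover have "subseq (y # B) (y # R)" using RB[of B] by simp
      ultimately have "subseq [c, b] (y # R)" using subseq_order.trans by blast
      then have "subseq ([x] @ [c, b]) (P @ y # R)"
        using xP by (intro list_emb_append_mono) (auto simp: subseq_singleton_left)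
      then show "\<not> b < c" using w \<open>x < b\<close> PR(1) unfolding avoids_132_iff_subseq by auto
    qed (use 1 xy in \<open>auto simp: A_def B_def\<close>)
    then show thesis using that v len by blast
  next
    case 2
    \<comment> \<open>Doubling the labels makes room for \<open>x\<close> immediately above \<open>y\<close>.\<close>
    define g where "g z = (if z = x then 2 * y + 1 else 2 * z)" for z
    have inj: "inj_on g (set w)" unfolding g_def inj_on_def by (auto split: if_splits; presburger)
    have gAB: "map g A = map ((*) 2) A" "map g B = map ((*) 2) B"
      by (auto simp: A_def B_def g_def)
    have "avoids_132 (map g A @ [g x, g y, g x] @ map g B)"
    proof (rule avoids_132_insert)
      have "avoids_132 (map ((*) 2) (A @ y # B))"
        using wu by (subst avoids_132_map) (auto simp: strict_mono_on_def)
      then show "avoids_132 (map g A @ g y # map g B)"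
        unfolding gAB using xy by (simp add: g_def)
    next
      fix a assume "a \<in> set (map g A)"
      then obtain a' where a': "a' \<in> set A" "a = 2 * a'" using gAB by auto
      then have "subseq ([a'] @ [x, y]) (P @ y # R)"
        using R(1) xy by (intro list_emb_append_mono) (auto simp: A_def subseq_singleton_left)
      then have "\<not> a' < y" using w 2 PR(1) unfolding avoids_132_iff_subseq by auto
      moreover have "a' \<noteq> y" using a' PR(2) by (auto simp: A_def)
      ultimately show "g x < a" using a' by (simp add: g_def)
    next
      fix b c assume s: "subseq [c, b] (g y # map g B)" "g x < b"
      show "\<not> b < c"
      proof (cases "c = g y")
        case True
        then show ?thesis using s(2) xy by (simp add: g_def)
      next
        case False
        then have "subseq [c, b] (map ((*) 2) B)" using s(1) gAB by auto
        then obtain c' b' where cb: "c = 2 * c'" "b = 2 * b'" "subseq [c', b'] B"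
          by (elim subseq_mapE) (auto simp: Cons_eq_map_conv)
        then have "subseq ([y] @ [c', b']) (y # R)" using RB by auto
        then have "subseq [y, c', b'] w" using PR(1) by (simp add: list_emb_append2)
        then show ?thesis using w s(2) cb unfolding avoids_132_iff_subseq by (auto simp: g_def)
      qed
    next
      fix b assume "b \<in> set (map g B)" "g y < b"
      then show "\<not> b < g x" using gAB xy by (auto simp: g_def)
    next
      have "odd (g x)" by (simp add: g_def)
      then show "g x \<notin> set (map g B)" unfolding gAB by auto
      show "g x \<noteq> g y" using \<open>odd (g x)\<close> xy by (auto simp: g_def)
    qed
    then have "avoids_132 (map g ?v)" by simp
    moreover have "alternation_iso g w (map g ?v)"
    proof -
      have "inj_on g (set ?v)" unfolding setv by (rule inj)
      from alternation_iso_trans[OF v alternation_iso_map[OF this]] show ?thesis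
        by (simp only: comp_id)
    qed
    ultimately show thesis using that[of g "map g ?v"] len by simp
  qed
qed

section \<open>Two occurrences suffice\<close>

text \<open>
  The new word is shorter because the rebuilt letter had three occurrences and keeps only two. When
  its neighbour also has three occurrences, both have a single neighbour, namely each other.
\<close>

lemma alternation_iso_shorter:
  fixes w :: "nat list"
  assumes w: "avoids_132 w" and x: "count_list w x \<ge> 3"
  obtains v :: "nat list" and g where "alternation_iso g w v" "avoids_132 v" "length v < length w"
proof -
  have xw: "x \<in> set w" using x count_notin by fastforce
  show thesis
  proof (cases "\<exists>y. alternate w x y")
    case False
    let ?p = "[x, x]"
    have avoids: "avoids_132 ?p" by (simp add: avoids_132_def)
    have alt: "alternate w s t \<longleftrightarrow> alternate ?p s t" if "s \<in> set ?p" for s t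
      using that False by (auto simp: alternate_def)
    have p_letters: "set ?p \<subseteq> set w" and twice: "\<And>z. z \<in> set ?p \<Longrightarrow> count_list ?p z \<ge> 2"
      using xw by auto
    obtain v :: "nat list" and g where v: "alternation_iso g w v" "avoids_132 v"
      "length v = length ?p + length (filter (\<lambda>z. z \<notin> set ?p) w)"
      by (rule alternation_iso_prepend[OF w p_letters avoids twice alt])
    then show thesis using that[of g v] length_filter_neq[of w x] x by simp
  next
    case True
    then obtain y where y: "alternate w x y" by blast
    show thesis
    proof (cases "count_list w y \<le> 2")
      case True
      then show thesis using alternation_iso_leaf[OF w y x] that by blast
    next
      case False
      then have y3: "count_list w y \<ge> 3" by simp
      have xy: "x \<noteq> y" "y \<in> set w" using y by (auto simp: alternate_def)
      have yx: "alternate w y x" using y alternate_commute[of w] by blast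
      have ux: "z = y" if "alternate w x z" for z
        using alternating_neighbour_unique[OF w x that y] .
      have uy: "z = x" if "alternate w y z" for z
        using alternating_neighbour_unique[OF w y3 that yx] .
      let ?p = "[x, y, x, y]"
      have p: "alternate ?p x z \<longleftrightarrow> z = y" "alternate ?p y z \<longleftrightarrow> z = x" for z
        using xy by (auto simp: alternate_iff_distinct_adj)
      have avoids: "avoids_132 ?p"
        unfolding avoids_132_iff_subseq by (auto dest!: set_subseq)
      have alt: "alternate w s t \<longleftrightarrow> alternate ?p s t" if "s \<in> set ?p" for s t
      proof -
        have "s = x \<or> s = y" using that by auto
        moreover have "alternate w x t \<longleftrightarrow> t = y" "alternate w y t \<longleftrightarrow> t = x"
          using y yx ux uy by blast+
        ultimately show ?thesis using p by (elim disjE) simp_all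
      qed
      have p_letters: "set ?p \<subseteq> set w" and twice: "\<And>z. z \<in> set ?p \<Longrightarrow> count_list ?p z \<ge> 2"
        using xw xy by auto
      obtain v :: "nat list" and g where "alternation_iso g w v" "avoids_132 v"
        "length v = length ?p + length (filter (\<lambda>z. z \<notin> set ?p) w)"
        by (rule alternation_iso_prepend[OF w p_letters avoids twice alt])
      moreover have "filter (\<lambda>z. z \<notin> set ?p) w = filter (\<lambda>z. z \<noteq> y) (filter (\<lambda>z. z \<noteq> x) w)"
        unfolding filter_filter by (rule filter_cong) auto
      moreover have "count_list (filter (\<lambda>z. z \<noteq> x) w) y = count_list w y"
        using xy(1) by (induction w) auto
      ultimately show thesis
        using that[of g v] length_filter_neq[of w x] length_filter_neq[of "filter (\<lambda>z. z \<noteq> x) w" y] x y3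
        by simp
    qed
  qed
qed

lemma alternation_iso_two_occurrences:
  fixes w :: "nat list"
  assumes "avoids_132 w"
  shows "\<exists>v :: nat list. \<exists>g. alternation_iso g w v \<and> avoids_132 v \<and> (\<forall>x\<in>set v. count_list v x \<le> 2)"
  using assms
proof (induction w rule: length_induct)
  case (1 w)
  show ?case
  proof (cases "\<forall>x\<in>set w. count_list w x \<le> 2")
    case True
    then show ?thesis using 1(2) alternation_iso_id[of w w] by blast
  next
    case False
    then obtain x where "\<not> count_list w x \<le> 2" by blast
    then have "count_list w x \<ge> 3" by simp
    from alternation_iso_shorter[OF 1(2) this] obtain u :: "nat list" and g
      where u: "alternation_iso g w u" "avoids_132 u" "length u < length w" by blast
    then obtain v :: "nat list" and h where v: "alternation_iso h u v" "avoids_132 v"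
      "\<forall>x\<in>set v. count_list v x \<le> 2"
      using 1(1) by blast
    then show ?thesis using alternation_iso_trans[OF u(1) v(1)] by blast
  qed
qed

lemma finite_linorder_enumeration:
  fixes S :: "'a :: linorder set"
  assumes "finite S" "card S = n"
  obtains h where "bij_betw h {..<n} S" "strict_mono_on {..<n} h"
proof
  let ?h = "(!) (sorted_list_of_set S)"
  show "bij_betw ?h {..<n} S" using assms by (intro bij_betw_nth) auto
  show "strict_mono_on {..<n} ?h"
    using assms sorted_wrt_nth_less[OF strict_sorted_list_of_set[of S]]
    by (auto simp: strict_mono_on_def)
qed

text \<open>
  The label type may have no more elements than \<open>w\<close> has letters, so the letters of the new word are
  mapped back onto exactly those of \<open>w\<close>, matching ranks.
\<close>

lemma avoids_132_two_occurrences: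
  fixes w :: "'b :: linorder list"
  assumes "avoids_132 w"
  obtains v :: "'b list" and g where "alternation_iso g w v" "avoids_132 v" "\<And>x. count_list v x \<le> 2"
proof -
  define n where "n = card (set w)"
  obtain h where h: "bij_betw h {..<n} (set w)" "strict_mono_on {..<n} h"
    using finite_linorder_enumeration[of "set w" n] by (auto simp: n_def)
  define h' where "h' = inv_into {..<n} h"
  define w' where "w' = map h' w"
  have h': "bij_betw h' (set w) {..<n}" unfolding h'_def using h(1) by (rule bij_betw_inv_into)
  have w': "set w' = {..<n}" using h' by (simp add: w'_def bij_betw_def)
  have "map h w' = w"
    unfolding w'_def h'_def using h(1) by (auto simp: bij_betw_def f_inv_into_f intro!: map_idI)
  then have "avoids_132 w'" using assms h(2) w' avoids_132_map[of w' h] by simp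
  then obtain v' :: "nat list" and g where v': "alternation_iso g w' v'" "avoids_132 v'"
    "\<forall>x\<in>set v'. count_list v' x \<le> 2"
    using alternation_iso_two_occurrences by blast
  have "card (set v') = n"
    using v'(1) w' bij_betw_same_card by (fastforce simp: alternation_iso_def)
  then obtain k where k: "bij_betw k {..<n} (set v')" "strict_mono_on {..<n} k"
    using finite_linorder_enumeration[of "set v'" n] by auto
  define k' where "k' = inv_into {..<n} k"
  have k': "bij_betw k' (set v') {..<n}" unfolding k'_def using k(1) by (rule bij_betw_inv_into)
  have "map k (map k' v') = v'"
    unfolding k'_def using k(1) by (auto simp: bij_betw_def f_inv_into_f intro!: map_idI)
  define v'' where "v'' = map k' v'"
  have v'': "set v'' = {..<n}" using k' by (simp add: v''_def bij_betw_def)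
  have "avoids_132 v''"
    using v'(2) \<open>map k (map k' v') = v'\<close> k(2) v'' avoids_132_map[of v'' k] by (simp add: v''_def)
  then have "avoids_132 (map h v'')" using h(2) v'' avoids_132_map[of v'' h] by simp
  moreover have "alternation_iso (h \<circ> (k' \<circ> (g \<circ> h'))) w (map h v'')"
  proof (intro alternation_iso_trans)
    show "alternation_iso h' w w'" unfolding w'_def using h' by (intro alternation_iso_map) (auto simp: bij_betw_def)
    show "alternation_iso g w' v'" by fact
    show "alternation_iso k' v' v''" unfolding v''_def using k' by (intro alternation_iso_map) (auto simp: bij_betw_def)
    show "alternation_iso h v'' (map h v'')" using h v'' by (intro alternation_iso_map) (auto simp: bij_betw_def)
  qed
  moreover have "count_list (map h v'') x \<le> 2" for x
  proof (cases "x \<in> set (map h v'')")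
    case True
    let ?m = "h \<circ> k'"
    have inj: "inj_on ?m (set v')"
      using h k' by (auto simp: bij_betw_def intro: comp_inj_on)
    have "map h v'' = map ?m v'" by (simp add: v''_def)
    then obtain t where "t \<in> set v'" "x = ?m t" using True by auto
    then show ?thesis
      using count_list_inj_map[OF inj, of t] v'(3) \<open>map h v'' = map ?m v'\<close> by simp
  qed simp
  ultimately show thesis using that by blast
qed

text \<open>
  Since \<open>f\<close> is injective and \<open>G\<close> has no loops, representing the relabelled graph can be read off
  from the arcs of \<open>G\<close>, the diagonal included.
\<close>

lemma represents_relabel_iff:
  assumes "pair_graph G" "inj_on f (pverts G)"
  shows "represents w (relabel f G) \<longleftrightarrow> set w = f ` pverts G \<and>
    (\<forall>a\<in>pverts G. \<forall>b\<in>pverts G. alternate w (f a) (f b) \<longleftrightarrow> (a, b) \<in> parcs G)"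
proof -
  interpret pair_graph G by fact
  have arc_verts: "fst e \<in> pverts G" "snd e \<in> pverts G" if "e \<in> parcs G" for e
    using that by (rule arc_fst_in_verts, rule arc_snd_in_verts)
  have loop: "(a, a) \<notin> parcs G" for a
    using no_loops'[of a a] by iprover
  have key: "(f a \<noteq> f b \<longrightarrow> (alternate w (f a) (f b) \<longleftrightarrow> (f a, f b) \<in> map_prod f f ` parcs G)) \<longleftrightarrow>
      (alternate w (f a) (f b) \<longleftrightarrow> (a, b) \<in> parcs G)"
    if ab: "a \<in> pverts G" "b \<in> pverts G" for a b
  proof (cases "a = b")
    case True
    then show ?thesis using loop[of a] by (simp add: alternate_def)
  next
    case False
    then have "f a \<noteq> f b" using assms(2) ab by (simp add: inj_on_eq_iff)
    moreover have "(f a, f b) \<in> map_prod f f ` parcs G \<longleftrightarrow> (a, b) \<in> parcs G"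
    proof
      assume "(f a, f b) \<in> map_prod f f ` parcs G"
      then obtain c d where cd: "(c, d) \<in> parcs G" "f a = f c" "f b = f d"
        by (elim imageE) (simp add: map_prod_def split: prod.splits)
      have "a = c" using cd(2) ab(1) arc_verts(1)[OF cd(1)] by (intro inj_onD[OF assms(2)]) simp_all
      moreover have "b = d" using cd(3) ab(2) arc_verts(2)[OF cd(1)] by (intro inj_onD[OF assms(2)]) simp_all
      ultimately show "(a, b) \<in> parcs G" using cd(1) by simp
    next
      assume "(a, b) \<in> parcs G"
      then show "(f a, f b) \<in> map_prod f f ` parcs G" by (rule rev_image_eqI) simp
    qed
    ultimately show ?thesis by simp
  qed
  have "(\<forall>x\<in>f ` pverts G. \<forall>y\<in>f ` pverts G. x \<noteq> y \<longrightarrow>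
        (alternate w x y \<longleftrightarrow> (x, y) \<in> map_prod f f ` parcs G)) \<longleftrightarrow>
      (\<forall>a\<in>pverts G. \<forall>b\<in>pverts G. alternate w (f a) (f b) \<longleftrightarrow> (a, b) \<in> parcs G)"
    unfolding ball_simps(9) by (intro ball_cong refl) (rule key)
  then show ?thesis
    unfolding represents_def relabel_def pair_pre_digraph.select_convs by (rule arg_cong)
qed

theorem theorem3p4:
  fixes G :: "'a pair_pre_digraph"
  assumes "pair_graph G"
    and "representable_132 TYPE('b::linorder) G"
  shows "\<exists>(f :: 'a \<Rightarrow> 'b) w. inj_on f (pverts G) \<and> avoids_132 w \<and> represents w (relabel f G) \<and>
    (\<forall>x\<in>set w. count_list w x \<le> 2)"
proof -
  obtain f :: "'a \<Rightarrow> 'b" and w where f: "inj_on f (pverts G)" "avoids_132 w"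
    "represents w (relabel f G)"
    using assms(2) unfolding representable_132_def by blast
  obtain v :: "'b list" and g where v: "alternation_iso g w v" "avoids_132 v" "\<And>x. count_list v x \<le> 2"
    using avoids_132_two_occurrences[OF f(2)] by blast
  have w: "set w = f ` pverts G"
    and edge: "a \<in> pverts G \<Longrightarrow> b \<in> pverts G \<Longrightarrow> alternate w (f a) (f b) \<longleftrightarrow> (a, b) \<in> parcs G" for a b
    using f(3) unfolding represents_relabel_iff[OF assms(1) f(1)] by blast+
  have g: "inj_on g (set w)" "set v = g ` set w"
    and alt: "x \<in> set w \<Longrightarrow> y \<in> set w \<Longrightarrow> alternate v (g x) (g y) \<longleftrightarrow> alternate w x y" for x y
    using v(1) unfolding alternation_iso_def bij_betw_def by auto
  have inj: "inj_on (g \<circ> f) (pverts G)" using f(1) g(1) unfolding w by (rule comp_inj_on)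
  have "set v = (g \<circ> f) ` pverts G" using g(2) w by (simp add: image_comp)
  then have "represents v (relabel (g \<circ> f) G)"
    using alt edge w unfolding represents_relabel_iff[OF assms(1) inj] by simp
  then show ?thesis using inj v(2,3) by blast
qed

end
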